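(* The following discrete divergence-free field conservation laws hold true for the solutions $\mathbf{E}^{t_{end}},\mathbf{H}^{t_{end}}$ produced by the fully discrete scheme defined in the context: $$\widetilde{\nabla}\cdot(\varepsilon\mathbf{E}^{t_{end}})=\widetilde{\nabla}\cdot(\varepsilon\mathbf{E}^0),\qquad \widetilde{\nabla}\cdot(\mu\mathbf{H}^{t_{end}})=\widetilde{\nabla}\cdot(\mu\mathbf{H}^0),$$ where $$\widetilde{\nabla}\cdot(\varepsilon\mathbf{E}^t)=\mathbf{D}_1(\varepsilon\mathbf{E}_x^t)+\mathbf{D}_2(\varepsilon\mathbf{E}_y^t)+\mathbf{D}_3(\varepsilon\mathbf{E}_z^t),\qquad \widetilde{\nabla}\cdot(\mu\mathbf{H}^t)=\mathbf{D}_1(\mu\mathbf{H}_x^t)+\mathbf{D}_2(\mu\mathbf{H}_y^t)+\mathbf{D}_3(\mu\mathbf{H}_z^t),$$ with $\mathbf{D}_1=I_{N_z}\otimes I_{N_y}\otimes D_x$, $\mathbf{D}_2=I_{N_z}\otimes D_y\otimes I_{N_x}$, $\mathbf{D}_3=D_z\otimes I_{N_y}\otimes I_{N_x}$.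
   Context: **Setting.** $\varepsilon,\mu>0$ are constants. The scheme approximates Maxwell's equations $\partial_t\mathbf{H}=-\frac1\mu\mathbf{curl}\,\mathbf{E}$, $\partial_t\mathbf{E}=\frac1\varepsilon\mathbf{curl}\,\mathbf{H}$, $\nabla\cdot(\varepsilon\mathbf{E})=0$, $\nabla\cdot(\varepsilon\mathbf{H})=0$ for $\mathbb{R}^3$-valued $\mathbf{H}=(H_x,H_y,H_z)^\intercal$, $\mathbf{E}=(E_x,E_y,E_z)^\intercal$ on $\Omega\times[0,t_{end}]$, $\Omega=[x_L,x_R]\times[y_L,y_R]\times[z_L,z_R]$, with periodic boundary conditions and given initial values. **Grid.** For $w\in\{x,y,z\}$, $N_w$ is a positive even integer, $h_w=(w_R-w_L)/N_w$, $x_j=x_L+(j-1)h_x$, $y_k=y_L+(k-1)h_y$, $z_l=z_L+(l-1)h_z$ for $1\le j\le N_x$, $1\le k\le N_y$, $1\le l\le N_z$. A grid function is identified with the vector in $\mathbb{C}^{N_xN_yN_z}$ whose entry number $N_xN_y(l-1)+N_x(k-1)+j$ is its value at $(x_j,y_k,z_l)$. $I_m$ is the $m\times m$ identity and $\otimes$ the Kronecker product. **Matrices.** $\nu_w=2\pi/(w_R-w_L)$. $D_w$ is the $N_w\times N_w$ spectral differentiation matrix with $(D_w)_{j,l}=\frac12\nu_w(-1)^{j+l}\cot(\nu_w(w_j-w_l)/2)$ for $j\ne l$ and zero diagonal. $\mathcal{F}_{N_w}$ is the DFT matrix with entries $(e^{2\pi\mathrm{i}/N_w})^{-jk}$, $0\le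 j,k\le N_w-1$, and $\mathcal{F}_{N_w}^{-1}$ its inverse, with entries $\frac1{N_w}(e^{2\pi\mathrm{i}/N_w})^{jk}$. Put $\Omega_w=\nu_w\,\mathrm{diag}(0,1,\ldots,\frac{N_w}2-1,0,-\frac{N_w}2+1,\ldots,-2,-1)$, $\Omega_1=I_{N_z}\otimes I_{N_y}\otimes\Omega_x$, $\Omega_2=I_{N_z}\otimes\Omega_y\otimes I_{N_x}$, $\Omega_3=\Omega_z\otimes I_{N_y}\otimes I_{N_x}$. For $\tau\ge0$ put $\Psi=\tau^2(\Omega_1^2+\Omega_2^2+\Omega_3^2)$ and let $A=\frac{\cosh(\sqrt{-\Psi})-I}{\Psi}$, $B=\frac{\sinh(\sqrt{-\Psi})}{\sqrt{-\Psi}}$ be the diagonal matrices obtained entrywise (with the value by continuity, $-1/2$ and $1$ respectively, where the diagonal entry of $\Psi$ is $0$). Define $\mathbf{c}_{11}=I+\tau^2(\Omega_3^2+\Omega_2^2)A$, $\mathbf{c}_{22}=I+\tau^2(\Omega_3^2+\Omega_1^2)A$, $\mathbf{c}_{33}=I+\tau^2(\Omega_2^2+\Omega_1^2)A$, $\mathbf{c}_{12}=-\tau^2\Omega_2\Omega_1A$, $\mathbf{c}_{13}=-\tau^2\Omega_3\Omega_1A$, $\mathbf{c}_{23}=-\tau^2\Omega_3\Omega_2A$, $\mathbf{s}_{12}=\mathrm{i}\tau\Omega_3B$, $\mathbf{s}_{13}=\mathrm{i}\tau\Omega_2B$, $\mathbf{s}_{23}=\mathrm{i}\tau\Omega_1B$.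 **Fully discrete scheme.** Let $\mathbf{E}^0_w,\mathbf{H}^0_w$ be the (real) vectors of values of $E_w(\cdot,0),H_w(\cdot,0)$ at the grid points, and $\widehat{\mathbf{E}}^0_w=(\mathcal{F}_{N_z}\otimes\mathcal{F}_{N_y}\otimes\mathcal{F}_{N_x})\mathbf{E}^0_w$, $\widehat{\mathbf{H}}^0_w=(\mathcal{F}_{N_z}\otimes\mathcal{F}_{N_y}\otimes\mathcal{F}_{N_x})\mathbf{H}^0_w$. For a time $t\ge0$, with $\tau=t/\sqrt{\mu\varepsilon}$, $$\mathbf{c}=\begin{pmatrix}\mathbf{c}_{11}&\mathbf{c}_{12}&\mathbf{c}_{13}\\\mathbf{c}_{12}&\mathbf{c}_{22}&\mathbf{c}_{23}\\\mathbf{c}_{13}&\mathbf{c}_{23}&\mathbf{c}_{33}\end{pmatrix},\qquad \mathbf{s}=\begin{pmatrix}\mathbf{0}&-\mathbf{s}_{12}&\mathbf{s}_{13}\\\mathbf{s}_{12}&\mathbf{0}&-\mathbf{s}_{23}\\-\mathbf{s}_{13}&\mathbf{s}_{23}&\mathbf{0}\end{pmatrix},$$ and $\widehat{\mathbf{E}}=(\widehat{\mathbf{E}}_x,\widehat{\mathbf{E}}_y,\widehat{\mathbf{E}}_z)^\intercal$, $\widehat{\mathbf{H}}=(\widehat{\mathbf{H}}_x,\widehat{\mathbf{H}}_y,\widehat{\mathbf{H}}_z)^\intercal$ (stacked), set $$\sqrt\mu\,\widehat{\mathbf{H}}^{t}=\sqrt\mu\,\mathbf{c}\,\widehat{\mathbf{H}}^0-\sqrt\varepsilon\,\mathbf{s}\,\widehat{\mathbf{E}}^0,\qquad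 \sqrt\varepsilon\,\widehat{\mathbf{E}}^{t}=\sqrt\varepsilon\,\mathbf{c}\,\widehat{\mathbf{E}}^0+\sqrt\mu\,\mathbf{s}\,\widehat{\mathbf{H}}^0,$$ $\mathbf{E}^{t}_w=(\mathcal{F}^{-1}_{N_z}\otimes\mathcal{F}^{-1}_{N_y}\otimes\mathcal{F}^{-1}_{N_x})\widehat{\mathbf{E}}^{t}_w$, $\mathbf{H}^{t}_w=(\mathcal{F}^{-1}_{N_z}\otimes\mathcal{F}^{-1}_{N_y}\otimes\mathcal{F}^{-1}_{N_x})\widehat{\mathbf{H}}^{t}_w$ for $w=x,y,z$, and $\mathbf{E}^t=(\mathbf{E}^t_x,\mathbf{E}^t_y,\mathbf{E}^t_z)^\intercal$, $\mathbf{H}^t=(\mathbf{H}^t_x,\mathbf{H}^t_y,\mathbf{H}^t_z)^\intercal$. The scheme's output is the case $t=t_{end}$. *)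

theory Defs
  imports "HOL-Analysis.Analysis" "Jordan_Normal_Form.Matrix"
begin

no_notation Finite_Cartesian_Product.vec_nth (infixl \<open>$\<close> 90)
notation Finite_Cartesian_Product.vec_nth (infixl \<open>$h\<close> 90)

hide_const (open) Finite_Cartesian_Product.vec Finite_Cartesian_Product.mat

text \<open>Matrices and vectors are indexed from 0: position \<open>i\<close> here is number \<open>i + 1\<close> in the usual
  1-based numbering.\<close>

definition kron :: "'a :: semiring_0 mat \<Rightarrow> 'a mat \<Rightarrow> 'a mat" (infixr \<open>\<otimes>\<^sub>k\<close> 73) where
  "A \<otimes>\<^sub>k B = Matrix.mat (dim_row A * dim_row B) (dim_col A * dim_col B)
     (\<lambda>(i, j). A $$ (i div dim_row B, j div dim_col B) * B $$ (i mod dim_row B, j mod dim_col B))"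

text \<open>The entrywise extension of a scalar function to diagonal matrices.\<close>

definition diag_fun :: "('a :: zero \<Rightarrow> 'a) \<Rightarrow> 'a mat \<Rightarrow> 'a mat" where
  "diag_fun f M = mat_diag (dim_row M) (\<lambda>i. f (M $$ (i, i)))"

definition block3 :: "nat \<Rightarrow> 'a mat list list \<Rightarrow> 'a mat" where
  "block3 n Ms = Matrix.mat (3 * n) (3 * n)
     (\<lambda>(i, j). (Ms ! (i div n) ! (j div n)) $$ (i mod n, j mod n))"

definition stack3 :: "'a vec \<Rightarrow> 'a vec \<Rightarrow> 'a vec \<Rightarrow> 'a vec" where
  "stack3 u v w = u @\<^sub>v (v @\<^sub>v w)"

text \<open>\<open>block n k v\<close> is the \<open>k\<close>-th block of length \<open>n\<close> of a stacked vector, where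
  \<open>k = 0, 1, 2\<close> corresponds to the components \<open>x, y, z\<close>.\<close>

definition block :: "nat \<Rightarrow> nat \<Rightarrow> 'a vec \<Rightarrow> 'a vec" where
  "block n k v = Matrix.vec n (\<lambda>i. v $ (k * n + i))"


text \<open>One space direction \<open>[a, b]\<close> with \<open>N\<close> grid points.\<close>

definition wave_nu :: "real \<Rightarrow> real \<Rightarrow> real" where
  "wave_nu a b = 2 * pi / (b - a)"

definition grid_node :: "real \<Rightarrow> real \<Rightarrow> nat \<Rightarrow> nat \<Rightarrow> real" where
  "grid_node a b N i = a + real i * ((b - a) / real N)"

text \<open>The sign \<open>(-1)^(j + l)\<close> is the same for 0-based and 1-based indices.\<close>

definition spectral_D :: "real \<Rightarrow> real \<Rightarrow> nat \<Rightarrow> complex mat" where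
  "spectral_D a b N = Matrix.mat N N (\<lambda>(j, l).
     if j = l then 0
     else complex_of_real (1/2 * wave_nu a b * (-1) ^ (j + l) *
       cot (wave_nu a b * (grid_node a b N j - grid_node a b N l) / 2)))"

definition DFT :: "nat \<Rightarrow> complex mat" where
  "DFT N = Matrix.mat N N (\<lambda>(j, k). exp (2 * complex_of_real pi * \<i> / of_nat N) powi (- (int j * int k)))"

definition inverse_DFT :: "nat \<Rightarrow> complex mat" where
  "inverse_DFT N = Matrix.mat N N (\<lambda>(j, k). 1 / of_nat N * exp (2 * complex_of_real pi * \<i> / of_nat N) ^ (j * k))"

text \<open>\<open>\<nu> diag(0, 1, \<dots>, N/2 - 1, 0, -N/2 + 1, \<dots>, -1)\<close>, for even \<open>N\<close>.\<close>

definition freq_mat :: "real \<Rightarrow> real \<Rightarrow> nat \<Rightarrow> complex mat" where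
  "freq_mat a b N = complex_of_real (wave_nu a b) \<cdot>\<^sub>m mat_diag N (\<lambda>i.
     if i < N div 2 then of_nat i
     else if i = N div 2 then 0
     else of_nat i - of_nat N)"


record grid =
  x_L :: real  x_R :: real
  y_L :: real  y_R :: real
  z_L :: real  z_R :: real
  N_x :: nat  N_y :: nat  N_z :: nat

definition valid_grid :: "grid \<Rightarrow> bool" where
  "valid_grid G \<longleftrightarrow> x_L G < x_R G \<and> y_L G < y_R G \<and> z_L G < z_R G \<and>
     0 < N_x G \<and> even (N_x G) \<and> 0 < N_y G \<and> even (N_y G) \<and> 0 < N_z G \<and> even (N_z G)"

definition grid_size :: "grid \<Rightarrow> nat" where
  "grid_size G = N_x G * N_y G * N_z G"

text \<open>The index \<open>i = N_x N_y l + N_x k + j\<close> (0-based \<open>j, k, l\<close>) carries the value at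
  \<open>(x_j, y_k, z_l)\<close>.\<close>

definition grid_point :: "grid \<Rightarrow> nat \<Rightarrow> real ^ 3" where
  "grid_point G i = vector
     [grid_node (x_L G) (x_R G) (N_x G) (i mod N_x G),
      grid_node (y_L G) (y_R G) (N_y G) (i div N_x G mod N_y G),
      grid_node (z_L G) (z_R G) (N_z G) (i div (N_x G * N_y G))]"

definition sample :: "grid \<Rightarrow> (real ^ 3 \<Rightarrow> real) \<Rightarrow> complex vec" where
  "sample G u = Matrix.vec (grid_size G) (\<lambda>i. complex_of_real (u (grid_point G i)))"

definition sample_field :: "grid \<Rightarrow> (real ^ 3 \<Rightarrow> real ^ 3) \<Rightarrow> complex vec" where
  "sample_field G F =
     stack3 (sample G (\<lambda>p. F p $h 1)) (sample G (\<lambda>p. F p $h 2)) (sample G (\<lambda>p. F p $h 3))"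

definition DFT3 :: "grid \<Rightarrow> complex mat" where
  "DFT3 G = DFT (N_z G) \<otimes>\<^sub>k DFT (N_y G) \<otimes>\<^sub>k DFT (N_x G)"

definition inverse_DFT3 :: "grid \<Rightarrow> complex mat" where
  "inverse_DFT3 G = inverse_DFT (N_z G) \<otimes>\<^sub>k inverse_DFT (N_y G) \<otimes>\<^sub>k inverse_DFT (N_x G)"

definition apply_blocks :: "grid \<Rightarrow> complex mat \<Rightarrow> complex vec \<Rightarrow> complex vec" where
  "apply_blocks G M v = stack3
     (M *\<^sub>v block (grid_size G) 0 v) (M *\<^sub>v block (grid_size G) 1 v) (M *\<^sub>v block (grid_size G) 2 v)"

definition Omega1 :: "grid \<Rightarrow> complex mat" where
  "Omega1 G = 1\<^sub>m (N_z G) \<otimes>\<^sub>k 1\<^sub>m (N_y G) \<otimes>\<^sub>k freq_mat (x_L G) (x_R G) (N_x G)"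

definition Omega2 :: "grid \<Rightarrow> complex mat" where
  "Omega2 G = 1\<^sub>m (N_z G) \<otimes>\<^sub>k freq_mat (y_L G) (y_R G) (N_y G) \<otimes>\<^sub>k 1\<^sub>m (N_x G)"

definition Omega3 :: "grid \<Rightarrow> complex mat" where
  "Omega3 G = freq_mat (z_L G) (z_R G) (N_z G) \<otimes>\<^sub>k 1\<^sub>m (N_y G) \<otimes>\<^sub>k 1\<^sub>m (N_x G)"

definition D1 :: "grid \<Rightarrow> complex mat" where
  "D1 G = 1\<^sub>m (N_z G) \<otimes>\<^sub>k 1\<^sub>m (N_y G) \<otimes>\<^sub>k spectral_D (x_L G) (x_R G) (N_x G)"

definition D2 :: "grid \<Rightarrow> complex mat" where
  "D2 G = 1\<^sub>m (N_z G) \<otimes>\<^sub>k spectral_D (y_L G) (y_R G) (N_y G) \<otimes>\<^sub>k 1\<^sub>m (N_x G)"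

definition D3 :: "grid \<Rightarrow> complex mat" where
  "D3 G = spectral_D (z_L G) (z_R G) (N_z G) \<otimes>\<^sub>k 1\<^sub>m (N_y G) \<otimes>\<^sub>k 1\<^sub>m (N_x G)"

definition discrete_div :: "grid \<Rightarrow> complex vec \<Rightarrow> complex vec" where
  "discrete_div G V =
     D1 G *\<^sub>v block (grid_size G) 0 V + D2 G *\<^sub>v block (grid_size G) 1 V
       + D3 G *\<^sub>v block (grid_size G) 2 V"


definition Psi :: "grid \<Rightarrow> real \<Rightarrow> complex mat" where
  "Psi G \<tau> = complex_of_real (\<tau>\<^sup>2) \<cdot>\<^sub>m
     (Omega1 G ^\<^sub>m 2 + Omega2 G ^\<^sub>m 2 + Omega3 G ^\<^sub>m 2)"

text \<open>The values at 0 are the continuous extensions. Both functions are even in the square root,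
  so its branch is irrelevant.\<close>

definition matA :: "grid \<Rightarrow> real \<Rightarrow> complex mat" where
  "matA G \<tau> = diag_fun (\<lambda>\<psi>. if \<psi> = 0 then - 1/2 else (cosh (csqrt (- \<psi>)) - 1) / \<psi>) (Psi G \<tau>)"

definition matB :: "grid \<Rightarrow> real \<Rightarrow> complex mat" where
  "matB G \<tau> = diag_fun (\<lambda>\<psi>. if \<psi> = 0 then 1 else sinh (csqrt (- \<psi>)) / csqrt (- \<psi>)) (Psi G \<tau>)"

definition c11 :: "grid \<Rightarrow> real \<Rightarrow> complex mat" where
  "c11 G \<tau> = 1\<^sub>m (grid_size G)
     + complex_of_real (\<tau>\<^sup>2) \<cdot>\<^sub>m ((Omega3 G ^\<^sub>m 2 + Omega2 G ^\<^sub>m 2) * matA G \<tau>)"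

definition c22 :: "grid \<Rightarrow> real \<Rightarrow> complex mat" where
  "c22 G \<tau> = 1\<^sub>m (grid_size G)
     + complex_of_real (\<tau>\<^sup>2) \<cdot>\<^sub>m ((Omega3 G ^\<^sub>m 2 + Omega1 G ^\<^sub>m 2) * matA G \<tau>)"

definition c33 :: "grid \<Rightarrow> real \<Rightarrow> complex mat" where
  "c33 G \<tau> = 1\<^sub>m (grid_size G)
     + complex_of_real (\<tau>\<^sup>2) \<cdot>\<^sub>m ((Omega2 G ^\<^sub>m 2 + Omega1 G ^\<^sub>m 2) * matA G \<tau>)"

definition c12 :: "grid \<Rightarrow> real \<Rightarrow> complex mat" where
  "c12 G \<tau> = - complex_of_real (\<tau>\<^sup>2) \<cdot>\<^sub>m (Omega2 G * Omega1 G * matA G \<tau>)"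

definition c13 :: "grid \<Rightarrow> real \<Rightarrow> complex mat" where
  "c13 G \<tau> = - complex_of_real (\<tau>\<^sup>2) \<cdot>\<^sub>m (Omega3 G * Omega1 G * matA G \<tau>)"

definition c23 :: "grid \<Rightarrow> real \<Rightarrow> complex mat" where
  "c23 G \<tau> = - complex_of_real (\<tau>\<^sup>2) \<cdot>\<^sub>m (Omega3 G * Omega2 G * matA G \<tau>)"

definition s12 :: "grid \<Rightarrow> real \<Rightarrow> complex mat" where
  "s12 G \<tau> = (\<i> * complex_of_real \<tau>) \<cdot>\<^sub>m (Omega3 G * matB G \<tau>)"

definition s13 :: "grid \<Rightarrow> real \<Rightarrow> complex mat" where
  "s13 G \<tau> = (\<i> * complex_of_real \<tau>) \<cdot>\<^sub>m (Omega2 G * matB G \<tau>)"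

definition s23 :: "grid \<Rightarrow> real \<Rightarrow> complex mat" where
  "s23 G \<tau> = (\<i> * complex_of_real \<tau>) \<cdot>\<^sub>m (Omega1 G * matB G \<tau>)"

definition cmat :: "grid \<Rightarrow> real \<Rightarrow> complex mat" where
  "cmat G \<tau> = block3 (grid_size G)
     [[c11 G \<tau>, c12 G \<tau>, c13 G \<tau>],
      [c12 G \<tau>, c22 G \<tau>, c23 G \<tau>],
      [c13 G \<tau>, c23 G \<tau>, c33 G \<tau>]]"

definition smat :: "grid \<Rightarrow> real \<Rightarrow> complex mat" where
  "smat G \<tau> = (let Z = 0\<^sub>m (grid_size G) (grid_size G) in block3 (grid_size G)
     [[Z, - s12 G \<tau>, s13 G \<tau>],
      [s12 G \<tau>, Z, - s23 G \<tau>],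
      [- s13 G \<tau>, s23 G \<tau>, Z]])"

text \<open>The scheme prescribes \<open>\<surd>\<mu> H\<close> and \<open>\<surd>\<epsilon> E\<close> in Fourier space; since \<open>\<mu>, \<epsilon> > 0\<close> these are
  divided by \<open>\<surd>\<mu>\<close> and \<open>\<surd>\<epsilon>\<close>. The arguments \<open>E0, H0\<close> are the initial fields.\<close>

definition H_hat ::
    "grid \<Rightarrow> real \<Rightarrow> real \<Rightarrow> (real ^ 3 \<Rightarrow> real ^ 3) \<Rightarrow> (real ^ 3 \<Rightarrow> real ^ 3) \<Rightarrow> real \<Rightarrow> complex vec" where
  "H_hat G \<epsilon> \<mu> E0 H0 t = (let \<tau> = t / sqrt (\<mu> * \<epsilon>) in
     complex_of_real (1 / sqrt \<mu>) \<cdot>\<^sub>v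
       (complex_of_real (sqrt \<mu>) \<cdot>\<^sub>v (cmat G \<tau> *\<^sub>v apply_blocks G (DFT3 G) (sample_field G H0))
        - complex_of_real (sqrt \<epsilon>) \<cdot>\<^sub>v (smat G \<tau> *\<^sub>v apply_blocks G (DFT3 G) (sample_field G E0))))"

definition E_hat ::
    "grid \<Rightarrow> real \<Rightarrow> real \<Rightarrow> (real ^ 3 \<Rightarrow> real ^ 3) \<Rightarrow> (real ^ 3 \<Rightarrow> real ^ 3) \<Rightarrow> real \<Rightarrow> complex vec" where
  "E_hat G \<epsilon> \<mu> E0 H0 t = (let \<tau> = t / sqrt (\<mu> * \<epsilon>) in
     complex_of_real (1 / sqrt \<epsilon>) \<cdot>\<^sub>v
       (complex_of_real (sqrt \<epsilon>) \<cdot>\<^sub>v (cmat G \<tau> *\<^sub>v apply_blocks G (DFT3 G) (sample_field G E0))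
        + complex_of_real (sqrt \<mu>) \<cdot>\<^sub>v (smat G \<tau> *\<^sub>v apply_blocks G (DFT3 G) (sample_field G H0))))"

definition scheme_H ::
    "grid \<Rightarrow> real \<Rightarrow> real \<Rightarrow> (real ^ 3 \<Rightarrow> real ^ 3) \<Rightarrow> (real ^ 3 \<Rightarrow> real ^ 3) \<Rightarrow> real \<Rightarrow> complex vec" where
  "scheme_H G \<epsilon> \<mu> E0 H0 t = apply_blocks G (inverse_DFT3 G) (H_hat G \<epsilon> \<mu> E0 H0 t)"

definition scheme_E ::
    "grid \<Rightarrow> real \<Rightarrow> real \<Rightarrow> (real ^ 3 \<Rightarrow> real ^ 3) \<Rightarrow> (real ^ 3 \<Rightarrow> real ^ 3) \<Rightarrow> real \<Rightarrow> complex vec" where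
  "scheme_E G \<epsilon> \<mu> E0 H0 t = apply_blocks G (inverse_DFT3 G) (E_hat G \<epsilon> \<mu> E0 H0 t)"

end

theory Submission
  imports Defs "Jordan_Normal_Form.Determinant"
begin

text \<open>On even grids the differentiation matrix is \<open>D = F\<^sup>-\<^sup>1 (\<i> \<Omega>) F\<close>, so the discrete divergence is, in
  Fourier space, \<open>\<i> (\<Omega>\<^sub>1, \<Omega>\<^sub>2, \<Omega>\<^sub>3)\<close> applied to the three components. All blocks of \<open>c\<close> and \<open>s\<close>
  are diagonal, hence commute, and the form of their entries gives
  \<open>(\<Omega>\<^sub>1, \<Omega>\<^sub>2, \<Omega>\<^sub>3) c = (\<Omega>\<^sub>1, \<Omega>\<^sub>2, \<Omega>\<^sub>3)\<close> and \<open>(\<Omega>\<^sub>1, \<Omega>\<^sub>2, \<Omega>\<^sub>3) s = 0\<close>, whatever the diagonal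
  matrices \<open>A\<close> and \<open>B\<close> are.\<close>

section \<open>Kronecker products\<close>

lemma kron_carrier [simp]:
  assumes "A \<in> carrier_mat m n" and "B \<in> carrier_mat p q"
  shows "A \<otimes>\<^sub>k B \<in> carrier_mat (m * p) (n * q)"
  using assms unfolding kron_def by auto

lemma div_mod_less_mult:
  fixes i m n :: nat
  assumes "i < m * n"
  shows "i div n < m" and "i mod n < n"
proof -
  have "0 < n" using assms by (cases n) auto
  then show "i mod n < n" by simp
  show "i div n < m" using assms by (simp add: less_mult_imp_div_less)
qed

text \<open>The summation index \<open>k < n * q\<close> is traded for the pair
  \<open>(k div q, k mod q)\<close>. The resulting double sum factors, because in a commutative
  semiring the entries of \<open>B\<close> and \<open>C\<close> may be swapped.\<close>

lemma kron_mult: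
  fixes A B C D :: "'a :: comm_semiring_0 mat"
  assumes "A \<in> carrier_mat m n" and "B \<in> carrier_mat p q"
    and "C \<in> carrier_mat n r" and "D \<in> carrier_mat q s"
  shows "(A \<otimes>\<^sub>k B) * (C \<otimes>\<^sub>k D) = (A * C) \<otimes>\<^sub>k (B * D)"
proof (rule eq_matI)
  fix i j
  assume "i < dim_row ((A * C) \<otimes>\<^sub>k (B * D))" and "j < dim_col ((A * C) \<otimes>\<^sub>k (B * D))"
  then have i: "i < m * p" and j: "j < r * s" using assms by (auto simp: kron_def)
  note ij = div_mod_less_mult[OF i] div_mod_less_mult[OF j]
  have "((A \<otimes>\<^sub>k B) * (C \<otimes>\<^sub>k D)) $$ (i, j) = (\<Sum>k<n * q.
      (A $$ (i div p, k div q) * B $$ (i mod p, k mod q)) *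
      (C $$ (k div q, j div s) * D $$ (k mod q, j mod s)))"
    using assms i j by (auto simp: kron_def scalar_prod_def lessThan_atLeast0 intro!: sum.cong)
  also have "\<dots> = (\<Sum>a<n. \<Sum>b<q.
      (A $$ (i div p, a) * B $$ (i mod p, b)) * (C $$ (a, j div s) * D $$ (b, j mod s)))"
    unfolding sum_mult_product by (auto intro!: sum.cong)
  also have "\<dots> = (\<Sum>a<n. A $$ (i div p, a) * C $$ (a, j div s)) *
      (\<Sum>b<q. B $$ (i mod p, b) * D $$ (b, j mod s))"
    unfolding sum_product by (simp add: mult_ac)
  also have "\<dots> = ((A * C) \<otimes>\<^sub>k (B * D)) $$ (i, j)"
    using assms i j ij by (auto simp: kron_def scalar_prod_def lessThan_atLeast0)
  finally show "((A \<otimes>\<^sub>k B) * (C \<otimes>\<^sub>k D)) $$ (i, j) = ((A * C) \<otimes>\<^sub>k (B * D)) $$ (i, j)" .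
qed (use assms in \<open>auto simp: kron_def\<close>)

text \<open>An index is determined by its quotient and remainder modulo \<open>n\<close>, so off the
  diagonal at least one of the two factors vanishes.\<close>

lemma kron_mat_diag:
  "mat_diag m f \<otimes>\<^sub>k mat_diag n g = mat_diag (m * n) (\<lambda>i. f (i div n) * g (i mod n) :: 'a :: semiring_0)"
proof (rule eq_matI)
  fix i j
  assume "i < dim_row (mat_diag (m * n) (\<lambda>i. f (i div n) * g (i mod n)))"
    and "j < dim_col (mat_diag (m * n) (\<lambda>i. f (i div n) * g (i mod n)))"
  then have i: "i < m * n" and j: "j < m * n" by (auto simp: mat_diag_def)
  have "i = j \<longleftrightarrow> i div n = j div n \<and> i mod n = j mod n"
    by (metis div_mod_decomp)
  then show "(mat_diag m f \<otimes>\<^sub>k mat_diag n g) $$ (i, j)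
      = mat_diag (m * n) (\<lambda>i. f (i div n) * g (i mod n)) $$ (i, j)"
    using i j div_mod_less_mult[OF i] div_mod_less_mult[OF j] by (auto simp: kron_def mat_diag_def)
qed (auto simp: kron_def mat_diag_def)

lemma kron_one: "1\<^sub>m m \<otimes>\<^sub>k 1\<^sub>m n = (1\<^sub>m (m * n) :: 'a :: semiring_1 mat)"
  unfolding mat_diag_one[symmetric] kron_mat_diag by simp

lemma smult_kron:
  "(c \<cdot>\<^sub>m A) \<otimes>\<^sub>k B = c \<cdot>\<^sub>m (A \<otimes>\<^sub>k B :: 'a :: comm_semiring_0 mat)"
proof (rule eq_matI)
  fix i j
  assume "i < dim_row (c \<cdot>\<^sub>m (A \<otimes>\<^sub>k B))" and "j < dim_col (c \<cdot>\<^sub>m (A \<otimes>\<^sub>k B))"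
  then have "i < dim_row A * dim_row B" and "j < dim_col A * dim_col B" by (auto simp: kron_def)
  then show "((c \<cdot>\<^sub>m A) \<otimes>\<^sub>k B) $$ (i, j) = (c \<cdot>\<^sub>m (A \<otimes>\<^sub>k B)) $$ (i, j)"
    using div_mod_less_mult by (auto simp: kron_def mult_ac)
qed (auto simp: kron_def)

lemma kron_smult:
  "A \<otimes>\<^sub>k (c \<cdot>\<^sub>m B) = c \<cdot>\<^sub>m (A \<otimes>\<^sub>k B :: 'a :: comm_semiring_0 mat)"
proof (rule eq_matI)
  fix i j
  assume "i < dim_row (c \<cdot>\<^sub>m (A \<otimes>\<^sub>k B))" and "j < dim_col (c \<cdot>\<^sub>m (A \<otimes>\<^sub>k B))"
  then have "i < dim_row A * dim_row B" and "j < dim_col A * dim_col B" by (auto simp: kron_def)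
  then show "(A \<otimes>\<^sub>k (c \<cdot>\<^sub>m B)) $$ (i, j) = (c \<cdot>\<^sub>m (A \<otimes>\<^sub>k B)) $$ (i, j)"
    using div_mod_less_mult by (auto simp: kron_def mult_ac)
qed (auto simp: kron_def)

section \<open>The discrete Fourier transform diagonalizes the differentiation matrix\<close>

text \<open>The diagonal of \<open>freq_mat\<close> without the factor \<open>wave_nu\<close>, so
  that the sums below involve integer frequencies only. The Nyquist mode \<open>N div 2\<close> has
  frequency 0.\<close>

definition freq :: "nat \<Rightarrow> nat \<Rightarrow> complex" where
  "freq N i = (if i < N div 2 then of_nat i else if i = N div 2 then 0 else of_nat i - of_nat N)"

lemma freq_mat_eq:
  "freq_mat a b N = mat_diag N (\<lambda>i. complex_of_real (wave_nu a b) * freq N i)"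
  unfolding freq_mat_def freq_def by (auto simp: mat_diag_def)

text \<open>Closed form of the arithmetic-geometric sum. When \<open>z ^ n = 1\<close> it collapses
  to \<open>of_nat n / (z - 1)\<close>.\<close>

lemma sum_of_nat_mult_power:
  fixes z :: "'a :: field"
  assumes "z \<noteq> 1"
  shows "(\<Sum>i<n. of_nat i * z ^ i) = (of_nat n * z ^ n - z * (z ^ n - 1) / (z - 1)) / (z - 1)"
proof (induction n)
  case (Suc n)
  then show ?case using assms by (simp add: divide_simps) (simp add: algebra_simps)
qed simp

text \<open>Removes the case distinction: the negative frequencies \<open>i - N\<close> with \<open>N/2 < i < N\<close> become the
  sum of all \<open>i z^i\<close> minus a geometric tail.\<close>

lemma sum_freq_mult_power:
  fixes z :: complex
  assumes N: "N = 2 * M" "0 < M"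
  shows "(\<Sum>i<N. freq N i * z ^ i)
    = (\<Sum>i<N. of_nat i * z ^ i) - of_nat M * z ^ M - of_nat N * ((\<Sum>i<N. z ^ i) - (\<Sum>i<Suc M. z ^ i))"
proof -
  have split: "(\<Sum>i<N. f i) = (\<Sum>i<M. f i) + f M + (\<Sum>i\<in>{Suc M..<N}. f i)" for f :: "nat \<Rightarrow> complex"
  proof -
    have "{..<N} = {..<Suc M} \<union> {Suc M..<N}" using N by auto
    then have "(\<Sum>i<N. f i) = (\<Sum>i<Suc M. f i) + (\<Sum>i\<in>{Suc M..<N}. f i)"
      by (simp add: sum.union_disjoint ivl_disj_int)
    then show ?thesis by simp
  qed
  have "(\<Sum>i\<in>{Suc M..<N}. freq N i * z ^ i)
      = (\<Sum>i\<in>{Suc M..<N}. of_nat i * z ^ i) - of_nat N * (\<Sum>i\<in>{Suc M..<N}. z ^ i)"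
    unfolding sum_distrib_left sum_subtractf[symmetric] using N
    by (intro sum.cong) (auto simp: freq_def algebra_simps)
  moreover have "(\<Sum>i<M. freq N i * z ^ i) = (\<Sum>i<M. of_nat i * z ^ i)"
    using N by (intro sum.cong) (auto simp: freq_def)
  \<comment> \<open>The full sum of \<open>of_nat i * z ^ i\<close> contains the Nyquist term
    \<open>of_nat M * z ^ M\<close>, which the vanishing frequency requires to be
    subtracted.\<close>
  moreover have "freq N M = 0" using N by (simp add: freq_def)
  ultimately show ?thesis
    unfolding split[of "\<lambda>i. freq N i * z ^ i"] split[of "\<lambda>i. of_nat i * z ^ i"] split[of "\<lambda>i. z ^ i"]
    by simp
qed

text \<open>Positive and negative frequencies cancel. This is the case \<open>z = 1\<close> of the
  preceding formula and yields the zero diagonal of \<open>spectral_D\<close>.\<close>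

lemma sum_freq_eq_0:
  assumes "even N" and "0 < N"
  shows "(\<Sum>i<N. freq N i) = 0"
proof -
  obtain M where M: "N = 2 * M" "0 < M" using assms by auto
  \<comment> \<open>The Gauss sum is kept doubled, which keeps the induction free of
    division.\<close>
  have *: "2 * (\<Sum>i<n. of_nat i :: complex) = of_nat n * (of_nat n - 1)" for n
    by (induction n) (auto simp: algebra_simps)
  have F: "(\<Sum>i<N. freq N i) = (\<Sum>i<N. of_nat i) - of_nat M - of_nat N * (of_nat N - of_nat M - 1)"
    using sum_freq_mult_power[OF M, of 1] by simp
  have "2 * (\<Sum>i<N. freq N i)
      = 2 * (\<Sum>i<N. of_nat i) - 2 * (of_nat M + of_nat N * (of_nat N - of_nat M - 1))"
    unfolding F by (simp add: algebra_simps)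
  also have "\<dots> = 0" unfolding * using M by (simp add: algebra_simps)
  finally show ?thesis by simp
qed

text \<open>The condition \<open>z ^ N = 1\<close> kills the full geometric sum, and
  \<open>N = 2 * M\<close> makes the constant terms cancel, leaving the quotient that becomes a
  cotangent.\<close>

lemma sum_freq_root_of_unity:
  assumes "N = 2 * M" and "0 < M" and "z ^ N = 1" and "z \<noteq> 1"
  shows "(\<Sum>i<N. freq N i * z ^ i) = of_nat M * z ^ M * (1 + z) / (z - 1)"
proof -
  have "(\<Sum>i<n. z ^ i) = (z ^ n - 1) / (z - 1)" for n
    using assms(4) by (simp add: geometric_sum)
  then have "(\<Sum>i<N. freq N i * z ^ i)
      = of_nat N / (z - 1) - of_nat M * z ^ M + of_nat N * ((z * z ^ M - 1) / (z - 1))"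
    unfolding sum_freq_mult_power[OF assms(1,2)] sum_of_nat_mult_power[OF assms(4)]
    using assms(3) by (simp add: right_diff_distrib del: sum.lessThan_Suc)
  also have "\<dots> = of_nat M * z ^ M * (1 + z) / (z - 1)"
    using assms(1,4) by (simp add: divide_simps) (simp add: algebra_simps)
  finally show ?thesis .
qed

text \<open>Pulling \<open>cis x\<close> out of numerator and denominator leaves
  \<open>2 cos x\<close> and \<open>2 \<i> sin x\<close>.\<close>

lemma cis_double_cot:
  assumes "sin x \<noteq> 0"
  shows "(1 + cis (2 * x)) / (cis (2 * x) - 1) = - \<i> * complex_of_real (cot x)"
proof -
  have s: "complex_of_real (sin x) \<noteq> 0" using assms by simp
  have 1: "1 + cis (2 * x) = cis x * (2 * complex_of_real (cos x))"
    by (simp add: complex_eq_iff cos_double_cos sin_double power2_eq_square)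
  have 2: "cis (2 * x) - 1 = cis x * (2 * \<i> * complex_of_real (sin x))"
    by (simp add: complex_eq_iff cos_double_sin sin_double power2_eq_square)
  show ?thesis unfolding 1 2 using s by (simp add: cot_def divide_simps)
qed

section \<open>Powers of the root of unity and entries of conjugated diagonal matrices\<close>

definition dft_root :: "nat \<Rightarrow> complex" where
  "dft_root N = cis (2 * pi / real N)"

lemma exp_eq_dft_root: "exp (2 * complex_of_real pi * \<i> / of_nat N) = dft_root N"
  unfolding dft_root_def cis_conv_exp by (simp add: mult_ac)

lemma dft_root_powi_power: "(dft_root N powi m) ^ k = cis (real k * (2 * pi * of_int m / real N))"
  unfolding dft_root_def cis_power_int Complex.DeMoivre by (simp add: mult_ac)

text \<open>A conjugated diagonal matrix is circulant: its entries depend on \<open>j - l\<close>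
  only. The case \<open>f = 1\<close> gives the inversion formula, and \<open>f\<close> proportional
  to \<open>freq N\<close> gives the differentiation matrix.\<close>

lemma inverse_DFT_diag_DFT:
  assumes "j < N" and "l < N"
  shows "(inverse_DFT N * mat_diag N f * DFT N) $$ (j, l)
    = (\<Sum>k<N. f k * (dft_root N powi (int j - int l)) ^ k) / of_nat N"
proof -
  have nz: "dft_root N \<noteq> 0" by (simp add: dft_root_def)
  have "dft_root N ^ (j * k) * dft_root N powi (- (int k * int l)) = (dft_root N powi (int j - int l)) ^ k" for k
  proof -
    have "dft_root N ^ (j * k) * dft_root N powi (- (int k * int l))
        = dft_root N powi (int j * int k) * dft_root N powi (- (int k * int l))"
      by (metis of_nat_mult power_int_of_nat)
    also have "\<dots> = dft_root N powi ((int j - int l) * int k)"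
      using nz by (simp add: power_int_add[symmetric] algebra_simps)
    finally show ?thesis by (simp add: power_int_mult)
  qed
  then show ?thesis
    using assms unfolding inverse_DFT_def DFT_def exp_eq_dft_root
    by (subst mat_diag_mult_right[of _ N])
      (auto simp: scalar_prod_def lessThan_atLeast0 sum_divide_distrib mult_ac intro!: sum.cong)
qed

lemma dft_root_powi_N: "0 < N \<Longrightarrow> (dft_root N powi m) ^ N = 1"
  by (simp add: dft_root_powi_power cis_multiple_2pi)

text \<open>A nonzero difference \<open>j - l\<close> is smaller than \<open>N\<close> in absolute
  value, so \<open>N\<close> cannot divide it and the half angle is no multiple of
  \<open>pi\<close>. This keeps the denominators of the geometric sums and of the cotangent away
  from 0.\<close>

lemma dft_root_half_angle:
  assumes "j < N" and "l < N" and "j \<noteq> l"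
  shows "sin (pi * (real j - real l) / real N) \<noteq> 0" and "dft_root N powi (int j - int l) \<noteq> 1"
    and "dft_root N powi (int j - int l) = cis (2 * (pi * (real j - real l) / real N))"
proof -
  show c: "dft_root N powi (int j - int l) = cis (2 * (pi * (real j - real l) / real N))"
    using dft_root_powi_power[of N "int j - int l" 1] by (simp add: mult_ac)
  show s: "sin (pi * (real j - real l) / real N) \<noteq> 0"
  proof
    assume "sin (pi * (real j - real l) / real N) = 0"
    then obtain i :: int where "pi * (real j - real l) / real N = of_int i * pi"
      by (auto simp: sin_zero_iff_int2)
    then have "pi * (real j - real l) = pi * (of_int i * real N)"
      using assms by (simp add: field_simps)
    then have "real_of_int (int j - int l) = real_of_int (i * int N)"
      by (simp only: mult_left_cancel[OF pi_neq_zero]) simp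
    then have "int j - int l = i * int N" by (simp only: of_int_eq_iff)
    then have "int N dvd int j - int l" by simp
    then show False using assms dvd_imp_le_int[of "int j - int l" "int N"] by auto
  qed
  show "dft_root N powi (int j - int l) \<noteq> 1"
  proof
    assume "dft_root N powi (int j - int l) = 1"
    then have "cos (2 * (pi * (real j - real l) / real N)) = 1"
      unfolding c by (simp add: complex_eq_iff)
    then show False using s by (simp only: cos_double_sin) simp
  qed
qed

lemma inverse_DFT_carrier [simp]: "inverse_DFT N \<in> carrier_mat N N"
  and DFT_carrier [simp]: "DFT N \<in> carrier_mat N N"
  and freq_mat_carrier [simp]: "freq_mat a b N \<in> carrier_mat N N"
  and spectral_D_carrier [simp]: "spectral_D a b N \<in> carrier_mat N N"
  unfolding inverse_DFT_def DFT_def freq_mat_def spectral_D_def by auto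

lemma inverse_DFT_mult_DFT:
  assumes "0 < N"
  shows "inverse_DFT N * DFT N = 1\<^sub>m N"
proof (rule eq_matI)
  fix j l assume "j < dim_row (1\<^sub>m N :: complex mat)" and "l < dim_col (1\<^sub>m N :: complex mat)"
  then have jl: "j < N" "l < N" by auto
  \<comment> \<open>Inserting the identity as a diagonal matrix brings the product into the form
    covered by \<open>inverse_DFT_diag_DFT\<close>.\<close>
  have "inverse_DFT N * DFT N = inverse_DFT N * mat_diag N (\<lambda>_. 1) * DFT N"
    by (simp add: right_mult_one_mat[OF inverse_DFT_carrier])
  then have "(inverse_DFT N * DFT N) $$ (j, l) = (\<Sum>k<N. (dft_root N powi (int j - int l)) ^ k) / of_nat N"
    by (simp only: inverse_DFT_diag_DFT[OF jl] mult_1)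
  also have "\<dots> = (if j = l then 1 else 0)"
    using assms dft_root_half_angle(2)[OF jl] by (auto simp: geometric_sum dft_root_powi_N)
  finally show "(inverse_DFT N * DFT N) $$ (j, l) = 1\<^sub>m N $$ (j, l)" using jl by simp
qed (auto simp: inverse_DFT_def DFT_def)

lemma DFT_mult_inverse_DFT:
  assumes "0 < N"
  shows "DFT N * inverse_DFT N = 1\<^sub>m N"
  by (rule mat_mult_left_right_inverse[OF _ _ inverse_DFT_mult_DFT[OF assms]]) auto

text \<open>The entries are compared one by one: the diagonal is the vanishing sum of frequencies,
  and off the diagonal the root-of-unity sum turns into the cotangent.\<close>

lemma spectral_D_eq:
  assumes "a < b" and "even N" and "0 < N"
  shows "spectral_D a b N = inverse_DFT N * (\<i> \<cdot>\<^sub>m freq_mat a b N) * DFT N"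
proof (rule eq_matI)
  fix j l
  assume "j < dim_row (inverse_DFT N * (\<i> \<cdot>\<^sub>m freq_mat a b N) * DFT N)"
    and "l < dim_col (inverse_DFT N * (\<i> \<cdot>\<^sub>m freq_mat a b N) * DFT N)"
  then have jl: "j < N" "l < N" by (auto simp: inverse_DFT_def DFT_def)
  obtain M where M: "N = 2 * M" "0 < M" using assms by auto
  define z where "z = dft_root N powi (int j - int l)"
  define \<nu> where "\<nu> = wave_nu a b"
  have diag: "\<i> \<cdot>\<^sub>m freq_mat a b N = mat_diag N (\<lambda>k. \<i> * complex_of_real \<nu> * freq N k)"
    unfolding freq_mat_eq \<nu>_def by (auto simp: mat_diag_def)
  have entry: "(inverse_DFT N * (\<i> \<cdot>\<^sub>m freq_mat a b N) * DFT N) $$ (j, l)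
      = \<i> * complex_of_real \<nu> * (\<Sum>k<N. freq N k * z ^ k) / of_nat N"
    unfolding diag inverse_DFT_diag_DFT[OF jl] z_def sum_distrib_left by (simp add: mult_ac)
  show "spectral_D a b N $$ (j, l) = (inverse_DFT N * (\<i> \<cdot>\<^sub>m freq_mat a b N) * DFT N) $$ (j, l)"
  proof (cases "j = l")
    case True
    then have "z = 1" by (simp add: z_def)
    then show ?thesis unfolding entry using True jl sum_freq_eq_0[OF assms(2,3)] by (simp add: spectral_D_def)
  next
    case False
    define x where "x = pi * (real j - real l) / real N"
    note half = dft_root_half_angle[OF jl False, folded z_def x_def]
    \<comment> \<open>Since \<open>M\<close> is half of \<open>N\<close>, the power is
      \<open>cis pi\<close> raised to \<open>j - l\<close>, a sign with the parity of
      \<open>j + l\<close>.\<close>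
    have "z ^ M = cis (pi * of_int (int j - int l))"
      unfolding z_def dft_root_powi_power using M by (intro arg_cong[of _ _ cis]) (simp add: field_simps)
    also have "\<dots> = cis pi powi (int j - int l)" by (simp only: cis_power_int mult.commute)
    also have "\<dots> = (-1) ^ (j + l)"
      by (cases "even j"; cases "even l") (auto simp: power_int_minus_left)
    finally have zM: "z ^ M = (-1) ^ (j + l)" .
    \<comment> \<open>Half the wave number times the mesh width is \<open>pi / N\<close>, so the
      interval length drops out.\<close>
    have node: "wave_nu a b * (grid_node a b N j - grid_node a b N l) / 2 = x"
      using assms unfolding wave_nu_def grid_node_def x_def by (simp add: field_simps)
    have "(\<Sum>k<N. freq N k * z ^ k) = of_nat M * z ^ M * ((1 + z) / (z - 1))"
      using sum_freq_root_of_unity[OF M _ half(2)] dft_root_powi_N[OF assms(3)] by (simp add: z_def)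
    also have "(1 + z) / (z - 1) = - \<i> * complex_of_real (cot x)"
      unfolding half(3) by (rule cis_double_cot[OF half(1)])
    \<comment> \<open>The factors \<open>\<i>\<close> and \<open>- \<i>\<close> multiply to 1, and
      \<open>M / N\<close> supplies the factor \<open>1/2\<close>.\<close>
    finally have "(inverse_DFT N * (\<i> \<cdot>\<^sub>m freq_mat a b N) * DFT N) $$ (j, l)
        = complex_of_real (1/2 * \<nu> * (-1) ^ (j + l) * cot x)"
      unfolding entry zM using M by (simp add: field_simps)
    then show ?thesis using jl False node by (simp add: spectral_D_def \<nu>_def)
  qed
qed (auto simp: inverse_DFT_def DFT_def spectral_D_def)

text \<open>Differentiation is moved past the inverse transform, the form that fits the output of
  the scheme.\<close>

lemma spectral_D_mult_inverse_DFT: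
  assumes "a < b" and "even N" and "0 < N"
  shows "spectral_D a b N * inverse_DFT N = inverse_DFT N * (\<i> \<cdot>\<^sub>m freq_mat a b N)"
proof -
  have "spectral_D a b N * inverse_DFT N
      = inverse_DFT N * (\<i> \<cdot>\<^sub>m freq_mat a b N) * (DFT N * inverse_DFT N)"
    unfolding spectral_D_eq[OF assms]
    by (rule assoc_mult_mat[of _ N N _ N _ N]) (auto intro!: mult_carrier_mat[of _ N N])
  then show ?thesis
    unfolding DFT_mult_inverse_DFT[OF assms(3)]
    by (simp add: right_mult_one_mat[of _ N N] mult_carrier_mat[of _ N N])
qed

section \<open>The transform on the three-dimensional grid\<close>

lemma grid_size_eq: "grid_size G = N_z G * (N_y G * N_x G)"
  unfolding grid_size_def by simp

lemma kron3_carrier: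
  assumes "A \<in> carrier_mat (N_z G) (N_z G)" and "B \<in> carrier_mat (N_y G) (N_y G)"
    and "C \<in> carrier_mat (N_x G) (N_x G)"
  shows "A \<otimes>\<^sub>k B \<otimes>\<^sub>k C \<in> carrier_mat (grid_size G) (grid_size G)"
  unfolding grid_size_eq using assms by (intro kron_carrier)

lemma kron3_mult:
  fixes A B C A' B' C' :: "'a :: comm_semiring_0 mat"
  assumes "A \<in> carrier_mat l l" and "B \<in> carrier_mat m m" and "C \<in> carrier_mat n n"
    and "A' \<in> carrier_mat l l" and "B' \<in> carrier_mat m m" and "C' \<in> carrier_mat n n"
  shows "(A \<otimes>\<^sub>k B \<otimes>\<^sub>k C) * (A' \<otimes>\<^sub>k B' \<otimes>\<^sub>k C') = (A * A') \<otimes>\<^sub>k (B * B') \<otimes>\<^sub>k (C * C')"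
  by (simp only: kron_mult[OF assms(1) kron_carrier[OF assms(2,3)] assms(4) kron_carrier[OF assms(5,6)]]
      kron_mult[OF assms(2,3,5,6)])

lemma grid_mat_carrier [simp]:
  "D1 G \<in> carrier_mat (grid_size G) (grid_size G)"
  "D2 G \<in> carrier_mat (grid_size G) (grid_size G)"
  "D3 G \<in> carrier_mat (grid_size G) (grid_size G)"
  "Omega1 G \<in> carrier_mat (grid_size G) (grid_size G)"
  "Omega2 G \<in> carrier_mat (grid_size G) (grid_size G)"
  "Omega3 G \<in> carrier_mat (grid_size G) (grid_size G)"
  "DFT3 G \<in> carrier_mat (grid_size G) (grid_size G)"
  "inverse_DFT3 G \<in> carrier_mat (grid_size G) (grid_size G)"
  unfolding D1_def D2_def D3_def Omega1_def Omega2_def Omega3_def DFT3_def inverse_DFT3_def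
  by (intro kron3_carrier; simp)+

lemma inverse_DFT3_mult_DFT3:
  assumes "valid_grid G"
  shows "inverse_DFT3 G * DFT3 G = 1\<^sub>m (grid_size G)"
  using assms unfolding inverse_DFT3_def DFT3_def grid_size_eq valid_grid_def
  by (simp add: kron3_mult[of _ "N_z G" _ "N_y G" _ "N_x G"] inverse_DFT_mult_DFT kron_one)

text \<open>By the mixed product rule each identity splits into the one-dimensional rule in the
  differentiated direction and trivial identities in the other two.\<close>

lemma spectral_mult_inverse_DFT3:
  assumes "valid_grid G"
  shows "D1 G * inverse_DFT3 G = inverse_DFT3 G * (\<i> \<cdot>\<^sub>m Omega1 G)"
    and "D2 G * inverse_DFT3 G = inverse_DFT3 G * (\<i> \<cdot>\<^sub>m Omega2 G)"
    and "D3 G * inverse_DFT3 G = inverse_DFT3 G * (\<i> \<cdot>\<^sub>m Omega3 G)"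
proof -
  \<comment> \<open>The scalar \<open>\<i>\<close> is moved onto the one factor that is not an
    identity matrix.\<close>
  have \<Omega>: "\<i> \<cdot>\<^sub>m Omega1 G = 1\<^sub>m (N_z G) \<otimes>\<^sub>k 1\<^sub>m (N_y G) \<otimes>\<^sub>k (\<i> \<cdot>\<^sub>m freq_mat (x_L G) (x_R G) (N_x G))"
    "\<i> \<cdot>\<^sub>m Omega2 G = 1\<^sub>m (N_z G) \<otimes>\<^sub>k (\<i> \<cdot>\<^sub>m freq_mat (y_L G) (y_R G) (N_y G)) \<otimes>\<^sub>k 1\<^sub>m (N_x G)"
    "\<i> \<cdot>\<^sub>m Omega3 G = (\<i> \<cdot>\<^sub>m freq_mat (z_L G) (z_R G) (N_z G)) \<otimes>\<^sub>k 1\<^sub>m (N_y G) \<otimes>\<^sub>k 1\<^sub>m (N_x G)"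
    unfolding Omega1_def Omega2_def Omega3_def by (simp_all only: kron_smult smult_kron)
  show "D1 G * inverse_DFT3 G = inverse_DFT3 G * (\<i> \<cdot>\<^sub>m Omega1 G)"
    and "D2 G * inverse_DFT3 G = inverse_DFT3 G * (\<i> \<cdot>\<^sub>m Omega2 G)"
    and "D3 G * inverse_DFT3 G = inverse_DFT3 G * (\<i> \<cdot>\<^sub>m Omega3 G)"
    using assms unfolding \<Omega> D1_def D2_def D3_def inverse_DFT3_def valid_grid_def
    by (simp_all add: kron3_mult[of _ "N_z G" _ "N_y G" _ "N_x G"] spectral_D_mult_inverse_DFT
        left_mult_one_mat[OF inverse_DFT_carrier] right_mult_one_mat[OF inverse_DFT_carrier])
qed

text \<open>The diagonals stay abstract: the cancellations below are polynomial identities in their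
  entries.\<close>

lemma Omega_diag:
  obtains w1 w2 w3 where "Omega1 G = mat_diag (grid_size G) w1"
    and "Omega2 G = mat_diag (grid_size G) w2" and "Omega3 G = mat_diag (grid_size G) w3"
  unfolding Omega1_def Omega2_def Omega3_def freq_mat_eq mat_diag_one[symmetric] kron_mat_diag grid_size_eq
  by blast

section \<open>Blocks of stacked vectors\<close>

lemma block_carrier [simp]: "block n k v \<in> carrier_vec n"
  by (simp add: block_def)

lemma less_mult_3:
  fixes i k n :: nat
  assumes "i < n" and "k < 3"
  shows "k * n + i < 3 * n"
proof -
  have "k * n + i < Suc k * n" using assms by simp
  also have "\<dots> \<le> 3 * n" using assms by (intro mult_right_mono) auto
  finally show ?thesis .
qed

lemma block_stack3:
  assumes "u \<in> carrier_vec n" and "v \<in> carrier_vec n" and "w \<in> carrier_vec n"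
  shows "block n 0 (stack3 u v w) = u" and "block n 1 (stack3 u v w) = v"
    and "block n 2 (stack3 u v w) = w"
  using assms by (auto simp: block_def stack3_def intro!: eq_vecI)

lemma block_smult:
  assumes "v \<in> carrier_vec (3 * n)" and "k < 3"
  shows "block n k (c \<cdot>\<^sub>v v) = c \<cdot>\<^sub>v block n k v"
  using assms less_mult_3[of _ n k] by (auto simp: block_def intro!: eq_vecI)

lemma stack3_carrier:
  assumes "u \<in> carrier_vec n" and "v \<in> carrier_vec n" and "w \<in> carrier_vec n"
  shows "stack3 u v w \<in> carrier_vec (3 * n)"
  using assms by (auto simp: stack3_def intro!: carrier_vecI)

lemma apply_blocks_carrier [simp]:
  assumes "M \<in> carrier_mat (grid_size G) (grid_size G)"
  shows "apply_blocks G M v \<in> carrier_vec (3 * grid_size G)"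
  unfolding apply_blocks_def
  by (intro stack3_carrier mult_mat_vec_carrier[OF assms] block_carrier)

lemma block_apply_blocks:
  assumes "M \<in> carrier_mat (grid_size G) (grid_size G)"
  shows "block (grid_size G) 0 (apply_blocks G M v) = M *\<^sub>v block (grid_size G) 0 v"
    and "block (grid_size G) 1 (apply_blocks G M v) = M *\<^sub>v block (grid_size G) 1 v"
    and "block (grid_size G) 2 (apply_blocks G M v) = M *\<^sub>v block (grid_size G) 2 v"
  unfolding apply_blocks_def
  by (intro block_stack3 mult_mat_vec_carrier[OF assms] block_carrier)+

lemma sample_field_carrier [simp]: "sample_field G F \<in> carrier_vec (3 * grid_size G)"
  unfolding sample_field_def by (rule stack3_carrier) (simp_all add: sample_def)

section \<open>Diagonal blocks acting on stacked vectors\<close>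

lemma sum_mat_diag:
  fixes d u :: "nat \<Rightarrow> 'a :: semiring_0"
  assumes "i < n"
  shows "(\<Sum>b<n. mat_diag n d $$ (i, b) * u b) = d i * u i"
proof -
  have "(\<Sum>b<n. mat_diag n d $$ (i, b) * u b) = (\<Sum>b<n. if b = i then d i * u i else 0)"
    using assms by (intro sum.cong) (auto simp: mat_diag_def)
  then show ?thesis using assms by simp
qed

text \<open>A column index is split into block number and offset, and each diagonal block keeps only
  the offset \<open>i\<close>. The large product thus becomes a 3 by 3 product for every
  frequency.\<close>

lemma block3_diag_mult_vec:
  fixes v :: "'a :: comm_semiring_0 vec"
  assumes "v \<in> carrier_vec (3 * n)" and "i < n" and "k < 3"
    and "Ms ! k = [mat_diag n f, mat_diag n g, mat_diag n h]"
  shows "(block3 n Ms *\<^sub>v v) $ (k * n + i) = f i * v $ i + g i * v $ (n + i) + h i * v $ (2 * n + i)"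
proof -
  have "(block3 n Ms *\<^sub>v v) $ (k * n + i)
      = (\<Sum>j<3 * n. (Ms ! k ! (j div n)) $$ (i, j mod n) * v $ j)"
    using assms less_mult_3[OF assms(2,3)] by (simp add: block3_def scalar_prod_def lessThan_atLeast0)
  also have "\<dots> = (\<Sum>a<3. \<Sum>b<n. (Ms ! k ! a) $$ (i, b) * v $ (b + a * n))"
    unfolding sum_mult_product by (intro sum.cong) auto
  also have "\<dots> = (\<Sum>b<n. mat_diag n f $$ (i, b) * v $ b) + (\<Sum>b<n. mat_diag n g $$ (i, b) * v $ (b + n))
      + (\<Sum>b<n. mat_diag n h $$ (i, b) * v $ (b + 2 * n))"
    unfolding assms(4) by (simp add: numeral_3_eq_3 numeral_2_eq_2)
  also have "\<dots> = f i * v $ i + g i * v $ (n + i) + h i * v $ (2 * n + i)"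
    unfolding sum_mat_diag[OF assms(2)] by (simp add: add.commute)
  finally show ?thesis .
qed

section \<open>The divergence in Fourier space\<close>

text \<open>The Fourier symbol of \<open>discrete_div\<close> up to the factor \<open>\<i>\<close>:
  the scalar product with the discrete wave vector.\<close>

definition spectral_div :: "grid \<Rightarrow> complex vec \<Rightarrow> complex vec" where
  "spectral_div G V =
     Omega1 G *\<^sub>v block (grid_size G) 0 V + Omega2 G *\<^sub>v block (grid_size G) 1 V
       + Omega3 G *\<^sub>v block (grid_size G) 2 V"

lemma discrete_div_inverse_DFT3:
  assumes "valid_grid G"
  shows "discrete_div G (apply_blocks G (inverse_DFT3 G) V) = inverse_DFT3 G *\<^sub>v (\<i> \<cdot>\<^sub>v spectral_div G V)"
proof -
  let ?n = "grid_size G" and ?F = "inverse_DFT3 G"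
  have *: "D *\<^sub>v (?F *\<^sub>v u) = ?F *\<^sub>v (\<i> \<cdot>\<^sub>v (M *\<^sub>v u))"
    if "D * ?F = ?F * (\<i> \<cdot>\<^sub>m M)" "D \<in> carrier_mat ?n ?n" "M \<in> carrier_mat ?n ?n" "u \<in> carrier_vec ?n" for D M u
  proof -
    have "D *\<^sub>v (?F *\<^sub>v u) = (?F * (\<i> \<cdot>\<^sub>m M)) *\<^sub>v u"
      unfolding that(1)[symmetric] using that(2,4) by (simp add: assoc_mult_mat_vec[of _ ?n ?n _ ?n])
    also have "\<dots> = ?F *\<^sub>v ((\<i> \<cdot>\<^sub>m M) *\<^sub>v u)"
      using that(3,4) by (simp add: assoc_mult_mat_vec[of _ ?n ?n _ ?n])
    also have "(\<i> \<cdot>\<^sub>m M) *\<^sub>v u = \<i> \<cdot>\<^sub>v (M *\<^sub>v u)"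
      using that(3,4) by (auto intro!: eq_vecI)
    finally show ?thesis .
  qed
  note mv = mult_mat_vec_carrier[of _ ?n ?n]
  show ?thesis
    unfolding discrete_div_def spectral_div_def block_apply_blocks[OF grid_mat_carrier(8)]
    by (simp add: *[OF spectral_mult_inverse_DFT3(1)[OF assms]] *[OF spectral_mult_inverse_DFT3(2)[OF assms]]
        *[OF spectral_mult_inverse_DFT3(3)[OF assms]] mv
        smult_add_distrib_vec[of _ ?n] mult_add_distrib_mat_vec[of _ ?n ?n])
qed

text \<open>The initial fields are thereby also written as inverse transforms, so that both sides
  can be compared in Fourier space.\<close>

lemma discrete_div_DFT3_inverse:
  assumes "valid_grid G"
  shows "discrete_div G (apply_blocks G (inverse_DFT3 G) (apply_blocks G (DFT3 G) V)) = discrete_div G V"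
proof -
  let ?n = "grid_size G"
  have "inverse_DFT3 G *\<^sub>v (DFT3 G *\<^sub>v block ?n k V) = block ?n k V" for k
    by (simp add: assoc_mult_mat_vec[of _ ?n ?n _ ?n, symmetric] inverse_DFT3_mult_DFT3[OF assms])
  then show ?thesis
    unfolding discrete_div_def block_apply_blocks[OF grid_mat_carrier(7)]
      block_apply_blocks[OF grid_mat_carrier(8)] by simp
qed

lemma discrete_div_smult:
  assumes "V \<in> carrier_vec (3 * grid_size G)"
  shows "discrete_div G (c \<cdot>\<^sub>v V) = c \<cdot>\<^sub>v discrete_div G V"
  using assms unfolding discrete_div_def
  by (simp add: block_smult mult_mat_vec[of _ "grid_size G" "grid_size G"]
      mult_mat_vec_carrier[of _ "grid_size G" "grid_size G"] smult_add_distrib_vec[of _ "grid_size G"])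

text \<open>The factors 0 and 1 come from addressing entry \<open>i\<close> of block
  \<open>k\<close> uniformly as \<open>k * n + i\<close>.\<close>

lemma spectral_div_diag:
  assumes "Omega1 G = mat_diag (grid_size G) w1" and "Omega2 G = mat_diag (grid_size G) w2"
    and "Omega3 G = mat_diag (grid_size G) w3"
  shows "spectral_div G V = Matrix.vec (grid_size G)
    (\<lambda>i. w1 i * V $ (0 * grid_size G + i) + w2 i * V $ (1 * grid_size G + i) + w3 i * V $ (2 * grid_size G + i))"
proof -
  have "mat_diag n d *\<^sub>v block n k V = Matrix.vec n (\<lambda>i. d i * V $ (k * n + i))" for n k and d :: "nat \<Rightarrow> complex"
  proof (rule eq_vecI)
    fix i assume "i < dim_vec (Matrix.vec n (\<lambda>i. d i * V $ (k * n + i)))"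
    then have i: "i < n" by simp
    then have "(mat_diag n d *\<^sub>v block n k V) $ i = (\<Sum>b<n. mat_diag n d $$ (i, b) * V $ (k * n + b))"
      by (simp add: mat_diag_def block_def scalar_prod_def lessThan_atLeast0)
    also have "\<dots> = d i * V $ (k * n + i)" by (rule sum_mat_diag[OF i])
    finally show "(mat_diag n d *\<^sub>v block n k V) $ i = Matrix.vec n (\<lambda>i. d i * V $ (k * n + i)) $ i"
      using i by simp
  qed (simp add: mat_diag_def)
  then show ?thesis unfolding spectral_div_def assms by (auto intro!: eq_vecI)
qed

lemma spectral_div_lincomb:
  assumes "U \<in> carrier_vec (3 * grid_size G)" and "V \<in> carrier_vec (3 * grid_size G)"
  shows "spectral_div G (a \<cdot>\<^sub>v (b \<cdot>\<^sub>v U + c \<cdot>\<^sub>v V))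
      = a \<cdot>\<^sub>v (b \<cdot>\<^sub>v spectral_div G U + c \<cdot>\<^sub>v spectral_div G V)"
proof -
  obtain w1 w2 w3 where w: "Omega1 G = mat_diag (grid_size G) w1"
    "Omega2 G = mat_diag (grid_size G) w2" "Omega3 G = mat_diag (grid_size G) w3" by (rule Omega_diag)
  show ?thesis
    using assms unfolding spectral_div_diag[OF w] by (auto simp: algebra_simps intro!: eq_vecI)
qed

section \<open>Arithmetic of diagonal matrices\<close>

lemma mat_diag_plus: "mat_diag n f + mat_diag n g = mat_diag n (\<lambda>i. f i + g i :: 'a :: monoid_add)"
  by (auto simp: mat_diag_def)

lemma mat_diag_smult: "c \<cdot>\<^sub>m mat_diag n f = mat_diag n (\<lambda>i. c * f i :: 'a :: semiring_0)"
  by (auto simp: mat_diag_def)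

lemma mat_diag_uminus: "- mat_diag n f = mat_diag n (\<lambda>i. - f i :: 'a :: group_add)"
  by (auto simp: mat_diag_def)

text \<open>Lets the zero blocks of \<open>smat\<close> count as diagonal, as
  \<open>block3_diag_mult_vec\<close> demands of all three blocks in a row.\<close>

lemma mat_diag_zero: "0\<^sub>m n n = mat_diag n (\<lambda>i. 0 :: 'a :: zero)"
  by (auto simp: mat_diag_def)

lemma mat_diag_pow2: "mat_diag n f ^\<^sub>m 2 = mat_diag n (\<lambda>i. f i * f i :: 'a :: semiring_1)"
  by (simp add: numeral_2_eq_2)

lemma diag_fun_Psi:
  obtains \<alpha> \<beta> where "matA G \<tau> = mat_diag (grid_size G) \<alpha>" and "matB G \<tau> = mat_diag (grid_size G) \<beta>"
proof -
  \<comment> \<open>A matrix sum takes its dimensions from the last summand, here the square of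
    \<open>Omega3 G\<close>.\<close>
  have "dim_row (Psi G \<tau>) = grid_size G"
    using carrier_matD[OF grid_mat_carrier(6), of G] unfolding Psi_def by (simp add: pow_mat_dim)
  then show thesis using that unfolding matA_def matB_def diag_fun_def by simp
qed

lemmas mat_diag_arith = mat_diag_diag mat_diag_plus mat_diag_smult mat_diag_uminus mat_diag_zero
  mat_diag_pow2 mat_diag_one[symmetric]

text \<open>At a frequency with wave vector \<open>w\<close>, the block matrix is the identity plus
  a multiple of \<open>|w|^2 I - w w^T\<close>, and \<open>w^T\<close> annihilates the
  latter.\<close>

lemma spectral_div_cmat:
  assumes "V \<in> carrier_vec (3 * grid_size G)"
  shows "spectral_div G (cmat G \<tau> *\<^sub>v V) = spectral_div G V"
proof -
  obtain w1 w2 w3 where w: "Omega1 G = mat_diag (grid_size G) w1"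
    "Omega2 G = mat_diag (grid_size G) w2" "Omega3 G = mat_diag (grid_size G) w3" by (rule Omega_diag)
  obtain \<alpha> \<beta> where ab: "matA G \<tau> = mat_diag (grid_size G) \<alpha>" "matB G \<tau> = mat_diag (grid_size G) \<beta>"
    by (rule diag_fun_Psi)
  show ?thesis
    unfolding spectral_div_diag[OF w] cmat_def c11_def c12_def c13_def c22_def c23_def c33_def w ab mat_diag_arith
    by (rule eq_vecI; simp add: block3_diag_mult_vec[OF assms, where k = 0, simplified]
        block3_diag_mult_vec[OF assms, where k = 1, simplified]
        block3_diag_mult_vec[OF assms, where k = 2, simplified])
      (simp_all add: algebra_simps)
qed

text \<open>At each frequency \<open>smat\<close> is a multiple of the cross product with the wave
  vector \<open>w\<close>, whose result is orthogonal to \<open>w\<close>: the discrete form of div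
  curl = 0.\<close>

lemma spectral_div_smat:
  assumes "V \<in> carrier_vec (3 * grid_size G)"
  shows "spectral_div G (smat G \<tau> *\<^sub>v V) = 0\<^sub>v (grid_size G)"
proof -
  obtain w1 w2 w3 where w: "Omega1 G = mat_diag (grid_size G) w1"
    "Omega2 G = mat_diag (grid_size G) w2" "Omega3 G = mat_diag (grid_size G) w3" by (rule Omega_diag)
  obtain \<alpha> \<beta> where ab: "matA G \<tau> = mat_diag (grid_size G) \<alpha>" "matB G \<tau> = mat_diag (grid_size G) \<beta>"
    by (rule diag_fun_Psi)
  show ?thesis
    unfolding spectral_div_diag[OF w] smat_def Let_def s12_def s13_def s23_def w ab mat_diag_arith
    by (rule eq_vecI; simp add: block3_diag_mult_vec[OF assms, where k = 0, simplified]
        block3_diag_mult_vec[OF assms, where k = 1, simplified]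
        block3_diag_mult_vec[OF assms, where k = 2, simplified])
      (simp_all add: algebra_simps)
qed

section \<open>Divergence of the computed fields\<close>

lemma cmat_smat_mult_carrier [simp]:
  "cmat G \<tau> *\<^sub>v V \<in> carrier_vec (3 * grid_size G)"
  "smat G \<tau> *\<^sub>v V \<in> carrier_vec (3 * grid_size G)"
  unfolding cmat_def smat_def Let_def by (auto simp: block3_def intro!: carrier_vecI)

text \<open>Covers both updates: \<open>a\<close> and \<open>b\<close> are \<open>1 / sqrt x\<close>
  and \<open>sqrt x\<close> with \<open>x\<close> one of \<epsilon>, \<mu>, while \<open>c\<close>
  carries the coupling coefficient with its sign.\<close>

lemma spectral_div_evolution:
  assumes "U \<in> carrier_vec (3 * grid_size G)" and "V \<in> carrier_vec (3 * grid_size G)" and "a * b = 1"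
  shows "spectral_div G (a \<cdot>\<^sub>v (b \<cdot>\<^sub>v (cmat G \<tau> *\<^sub>v U) + c \<cdot>\<^sub>v (smat G \<tau> *\<^sub>v V))) = spectral_div G U"
proof -
  have "spectral_div G U \<in> carrier_vec (grid_size G)"
    unfolding spectral_div_def by (intro add_carrier_vec mult_mat_vec_carrier[of _ _ "grid_size G"]) auto
  then show ?thesis
    using assms by (auto simp: spectral_div_lincomb spectral_div_cmat spectral_div_smat
        mult.assoc[symmetric] intro!: eq_vecI)
qed

lemma discrete_div_scheme:
  assumes "valid_grid G" and "0 < \<epsilon>" and "0 < \<mu>"
  shows "discrete_div G (scheme_E G \<epsilon> \<mu> E0 H0 t) = discrete_div G (sample_field G E0)"
    and "discrete_div G (scheme_H G \<epsilon> \<mu> E0 H0 t) = discrete_div G (sample_field G H0)"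
proof -
  let ?\<tau> = "t / sqrt (\<mu> * \<epsilon>)" and ?F = "\<lambda>F. apply_blocks G (DFT3 G) (sample_field G F)"
  have inv: "complex_of_real (1 / sqrt x) * complex_of_real (sqrt x) = 1" if "0 < x" for x
    using that by (simp flip: of_real_mult)
  have "spectral_div G (E_hat G \<epsilon> \<mu> E0 H0 t) = spectral_div G (?F E0)"
    unfolding E_hat_def Let_def by (intro spectral_div_evolution inv assms) simp_all
  then have "discrete_div G (scheme_E G \<epsilon> \<mu> E0 H0 t)
      = discrete_div G (apply_blocks G (inverse_DFT3 G) (?F E0))"
    unfolding scheme_E_def discrete_div_inverse_DFT3[OF assms(1)] by simp
  then show "discrete_div G (scheme_E G \<epsilon> \<mu> E0 H0 t) = discrete_div G (sample_field G E0)"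
    unfolding discrete_div_DFT3_inverse[OF assms(1)] .
  \<comment> \<open>The difference is rewritten as a sum with a negative coefficient to match
    \<open>spectral_div_evolution\<close>.\<close>
  have "complex_of_real (sqrt \<mu>) \<cdot>\<^sub>v (cmat G ?\<tau> *\<^sub>v ?F H0) - complex_of_real (sqrt \<epsilon>) \<cdot>\<^sub>v (smat G ?\<tau> *\<^sub>v ?F E0)
      = complex_of_real (sqrt \<mu>) \<cdot>\<^sub>v (cmat G ?\<tau> *\<^sub>v ?F H0) + (- complex_of_real (sqrt \<epsilon>)) \<cdot>\<^sub>v (smat G ?\<tau> *\<^sub>v ?F E0)"
    by (rule eq_vecI) (auto simp: cmat_def smat_def Let_def block3_def)
  then have "spectral_div G (H_hat G \<epsilon> \<mu> E0 H0 t) = spectral_div G (?F H0)"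
    unfolding H_hat_def Let_def by (simp only:) (intro spectral_div_evolution inv assms; simp)
  then have "discrete_div G (scheme_H G \<epsilon> \<mu> E0 H0 t)
      = discrete_div G (apply_blocks G (inverse_DFT3 G) (?F H0))"
    unfolding scheme_H_def discrete_div_inverse_DFT3[OF assms(1)] by simp
  then show "discrete_div G (scheme_H G \<epsilon> \<mu> E0 H0 t) = discrete_div G (sample_field G H0)"
    unfolding discrete_div_DFT3_inverse[OF assms(1)] .
qed

theorem theorem4p6:
  fixes G :: grid and \<epsilon> \<mu> t_end :: real
    and E0 H0 :: "real ^ 3 \<Rightarrow> real ^ 3"
  assumes "valid_grid G" and "0 < \<epsilon>" and "0 < \<mu>" and "0 \<le> t_end"
  shows "discrete_div G (complex_of_real \<epsilon> \<cdot>\<^sub>v scheme_E G \<epsilon> \<mu> E0 H0 t_end)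
           = discrete_div G (complex_of_real \<epsilon> \<cdot>\<^sub>v sample_field G E0)
       \<and> discrete_div G (complex_of_real \<mu> \<cdot>\<^sub>v scheme_H G \<epsilon> \<mu> E0 H0 t_end)
           = discrete_div G (complex_of_real \<mu> \<cdot>\<^sub>v sample_field G H0)"
  \<comment> \<open>The constants \<epsilon> and \<mu> leave the divergence by linearity.\<close>
  using discrete_div_scheme[OF assms(1-3)]
  by (simp add: discrete_div_smult scheme_E_def scheme_H_def)

end
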